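(* Let $p=\underline{p_{1}p_{2}\ldots p_{r}}$ be a consecutive pattern and let $d=\max_{i}\{p_{i}\}$. Then the vincular patterns $(d{+}1)\underline{p_{1}p_{2}\ldots p_{r}}$ and $(d{+}1)\underline{p_{r}p_{r-1}\ldots p_{1}}$ are Wilf equivalent, i.e., for every $n$ the number of inversion sequences of length $n$ avoiding $(d{+}1)\underline{p_{1}p_{2}\ldots p_{r}}$ equals the number of inversion sequences of length $n$ avoiding $(d{+}1)\underline{p_{r}p_{r-1}\ldots p_{1}}$.
   Context: An inversion sequence of length $n$ is a sequence $e=e_1e_2\dots e_n$ of integers with $0\le e_i<i$ for all $i$. The reduction of an integer word $w$ is obtained by replacing every instance of the $i$th smallest entry of $w$ by $i-1$. A vincular pattern is a sequence $q=q_1q_2\dots q_s$ with $q_i\in\{0,1,\dots,s-1\}$, where a value $j>0$ appears only if $j-1$ appears, and in which some disjoint subsequences of two or more adjacent entries may be underlined. An inversion sequence $e$ contains $q$ if there is a subsequence $e_{i_1}e_{i_2}\dots e_{i_s}$ (with $i_1<\dots<i_s$) whose reduction is $q$ and such that $i_{t+1}=i_t+1$ whenever $q_t$ and $q_{t+1}$ belong to the same underlined block; otherwise $e$ avoids $q$. A consecutive pattern is one in which all entries are underlined as a single block. Two vincular patterns are Wilf equivalent if, for every $n$, they are avoided by the same number of inversion sequences of length $n$. In the patterns of the claim, the first entry $d+1$ is not underlined and the remaining $r$ entries form one underlined block. *)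

theory Defs
  imports Main
begin

text \<open>Positions are counted from 0 here, so \<open>0 \<le> e\<^sub>i < i\<close> for the 1-based \<open>i\<close> becomes
  \<open>e ! i < Suc i\<close>.\<close>

definition inversion_sequences :: "nat \<Rightarrow> nat list set" where
  "inversion_sequences n = {e. length e = n \<and> (\<forall>i<n. e ! i < Suc i)}"

text \<open>The \<open>i\<close>th smallest of the distinct values in \<open>w\<close> has exactly \<open>i - 1\<close> distinct values
  of \<open>w\<close> below it.\<close>

definition reduction :: "nat list \<Rightarrow> nat list" where
  "reduction w = map (\<lambda>x. card {y \<in> set w. y < x}) w"

text \<open>A vincular pattern is represented by its word \<open>q\<^sub>1 \<dots> q\<^sub>s\<close> cut into consecutive nonempty
  blocks: a block of length at least 2 is an underlined block, a block of length 1 is an entry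
  that is not underlined.\<close>

type_synonym vpattern = "nat list list"

definition vincular_pattern :: "vpattern \<Rightarrow> bool" where
  "vincular_pattern q \<longleftrightarrow>
     (\<forall>b\<in>set q. b \<noteq> []) \<and>
     (\<forall>x\<in>set (concat q). x < length (concat q)) \<and>
     (\<forall>j\<in>set (concat q). j > 0 \<longrightarrow> j - 1 \<in> set (concat q))"

text \<open>For words \<open>p\<close> of length 1, underlining imposes no condition.\<close>

definition consecutive_pattern :: "nat list \<Rightarrow> bool" where
  "consecutive_pattern p \<longleftrightarrow> vincular_pattern [p]"

text \<open>Block \<open>k\<close> occupies the positions from \<open>length (concat (take k q))\<close> up to, but excluding,
  \<open>length (concat (take (Suc k) q))\<close> of the word; the following says that the positions \<open>t\<close> and
  \<open>t + 1\<close> both lie in one block.\<close>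

definition same_block :: "vpattern \<Rightarrow> nat \<Rightarrow> bool" where
  "same_block q t \<longleftrightarrow>
     (\<exists>k<length q. length (concat (take k q)) \<le> t \<and> Suc t < length (concat (take (Suc k) q)))"

definition occurrence :: "vpattern \<Rightarrow> nat list \<Rightarrow> nat list \<Rightarrow> bool" where
  "occurrence q e is \<longleftrightarrow>
     sorted_wrt (<) is \<and> set is \<subseteq> {..<length e} \<and>
     reduction (map (\<lambda>i. e ! i) is) = concat q \<and>
     (\<forall>t. Suc t < length is \<and> same_block q t \<longrightarrow> is ! Suc t = Suc (is ! t))"

definition contains :: "nat list \<Rightarrow> vpattern \<Rightarrow> bool" where
  "contains e q \<longleftrightarrow> (\<exists>is. occurrence q e is)"

definition avoids :: "nat list \<Rightarrow> vpattern \<Rightarrow> bool" where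
  "avoids e q \<longleftrightarrow> \<not> contains e q"

definition wilf_equivalent :: "vpattern \<Rightarrow> vpattern \<Rightarrow> bool" where
  "wilf_equivalent q q' \<longleftrightarrow>
     (\<forall>n. card {e \<in> inversion_sequences n. avoids e q} =
          card {e \<in> inversion_sequences n. avoids e q'})"

end

theory Submission
  imports Defs
begin

text \<open>An entry is a weak left-to-right maximum if no earlier entry exceeds it. A window whose
  entries all lie below some earlier entry contains no weak left-to-right maximum, so it lies
  strictly between two consecutive ones; conversely every window lying there is below an earlier
  entry. Hence \<open>e\<close> avoids \<open>(d+1)p\<close> iff every maximal run of entries between weak left-to-right
  maxima avoids the consecutive pattern \<open>p\<close>. Reversing each of these runs is an involution on
  inversion sequences that exchanges avoidance of \<open>p\<close> with avoidance of \<open>rev p\<close>.\<close>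

section \<open>Reversing the runs between weak left-to-right maxima\<close>

text \<open>The argument \<open>m\<close> is the maximum of the entries already read, and 0 at the start.\<close>

function reverse_runs :: "nat \<Rightarrow> nat list \<Rightarrow> nat list" where
  "reverse_runs m xs = rev (takeWhile (\<lambda>x. x < m) xs) @
     (case dropWhile (\<lambda>x. x < m) xs of [] \<Rightarrow> [] | y # ys \<Rightarrow> y # reverse_runs y ys)"
  by pat_completeness auto
termination
proof (relation "measure (length \<circ> snd)", simp)
  fix m :: nat and xs y ys
  assume "dropWhile (\<lambda>x. x < m) xs = y # ys"
  then have "length (y # ys) \<le> length xs"
    by (metis length_dropWhile_le)
  then show "((y, ys), m, xs) \<in> measure (length \<circ> snd)"
    by simp
qed

declare reverse_runs.simps [simp del]

text \<open>Splits a word at its weak left-to-right maxima: \<open>b\<close> is the run below the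
  current maximum \<open>m\<close>, and \<open>y\<close> is the next weak maximum, which replaces
  \<open>m\<close>. The later inductions thus need only the two equations
  \<open>reverse_runs_last\<close> and \<open>reverse_runs_run\<close>.\<close>

lemma runs_induct [case_names last run]:
  fixes P :: "nat \<Rightarrow> nat list \<Rightarrow> bool"
  assumes last: "\<And>m b. \<forall>x\<in>set b. x < m \<Longrightarrow> P m b"
    and run: "\<And>m b y ys. \<forall>x\<in>set b. x < m \<Longrightarrow> m \<le> y \<Longrightarrow> P y ys \<Longrightarrow> P m (b @ y # ys)"
  shows "P m xs"
proof (induction "length xs" arbitrary: m xs rule: less_induct)
  case less
  show ?case
  proof (cases "dropWhile (\<lambda>x. x < m) xs")
    case Nil
    then have "\<forall>x\<in>set xs. x < m"
      by simp
    then show ?thesis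
      by (rule last)
  next
    case (Cons y ys)
    define b where "b = takeWhile (\<lambda>x. x < m) xs"
    have xs: "xs = b @ y # ys"
      using takeWhile_dropWhile_id [of "\<lambda>x. x < m" xs] Cons by (simp add: b_def)
    have "\<forall>x\<in>set b. x < m"
      unfolding b_def by (blast dest: set_takeWhileD)
    moreover have "m \<le> y"
      using Cons by (simp add: dropWhile_eq_Cons_conv)
    moreover have "P y ys"
      by (rule less) (simp add: xs)
    ultimately show ?thesis
      unfolding xs by (rule run)
  qed
qed

lemma reverse_runs_last:
  "\<forall>x\<in>set b. x < m \<Longrightarrow> reverse_runs m b = rev b"
  by (subst reverse_runs.simps) (simp add: takeWhile_eq_all_conv [THEN iffD2] dropWhile_eq_Nil_conv [THEN iffD2])

lemma reverse_runs_run: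
  assumes "\<forall>x\<in>set b. x < m" "m \<le> y"
  shows "reverse_runs m (b @ y # ys) = rev b @ y # reverse_runs y ys"
  using assms
  by (subst reverse_runs.simps) (simp add: not_less)

text \<open>Reversal keeps each run below \<open>m\<close> and leaves each \<open>y\<close> in
  place, so the image is cut at the same positions and every run is reversed back.\<close>

lemma reverse_runs_involution: "reverse_runs m (reverse_runs m xs) = xs"
  by (induction m xs rule: runs_induct) (simp_all add: reverse_runs_last reverse_runs_run)

lemma length_reverse_runs: "length (reverse_runs m xs) = length xs"
  by (induction m xs rule: runs_induct) (simp_all add: reverse_runs_last reverse_runs_run)

text \<open>The offset \<open>k\<close> is the position at which a suffix starts, so that the bound
  on inversion sequences can be followed through the recursion on suffixes.\<close>

fun bounded_from :: "nat \<Rightarrow> nat list \<Rightarrow> bool" where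
  "bounded_from k [] \<longleftrightarrow> True"
| "bounded_from k (x # xs) \<longleftrightarrow> x \<le> k \<and> bounded_from (Suc k) xs"

lemma bounded_from_append:
  "bounded_from k (xs @ ys) \<longleftrightarrow> bounded_from k xs \<and> bounded_from (k + length xs) ys"
  by (induction k xs rule: bounded_from.induct) auto

lemma bounded_from_iff_nth: "bounded_from k xs \<longleftrightarrow> (\<forall>i<length xs. xs ! i \<le> k + i)"
  by (induction k xs rule: bounded_from.induct) (auto simp: less_Suc_eq_0_disj)

lemma bounded_from_below:
  "\<forall>x\<in>set b. x \<le> k \<Longrightarrow> bounded_from k b"
  by (simp add: bounded_from_iff_nth trans_le_add1)

text \<open>Entries of a run are below \<open>m \<le> k\<close>, hence within the bound at every
  position of the run in any order. The invariant passes on: \<open>y \<le> k + length b\<close>,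
  and the suffix after \<open>y\<close> starts one position later.\<close>

lemma bounded_from_reverse_runs:
  "m \<le> k \<Longrightarrow> bounded_from k xs \<Longrightarrow> bounded_from k (reverse_runs m xs)"
proof (induction m xs arbitrary: k rule: runs_induct)
  case (last m b)
  then have "bounded_from k (rev b)"
    by (intro bounded_from_below) force
  with last show ?case
    by (simp add: reverse_runs_last)
next
  case (run m b y ys)
  then have "bounded_from k (rev b)"
    by (intro bounded_from_below) force
  with run show ?case
    by (simp add: reverse_runs_run bounded_from_append)
qed

lemma inversion_sequences_bounded_from:
  "e \<in> inversion_sequences n \<longleftrightarrow> length e = n \<and> bounded_from 0 e"
  by (auto simp: inversion_sequences_def bounded_from_iff_nth less_Suc_eq_le)

lemma reverse_runs_inversion_sequences:
  "e \<in> inversion_sequences n \<Longrightarrow> reverse_runs 0 e \<in> inversion_sequences n"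
  by (simp add: inversion_sequences_bounded_from length_reverse_runs bounded_from_reverse_runs)

section \<open>Windows of a given reduction\<close>

lemma reduction_rev: "reduction (rev w) = rev (reduction w)"
  by (simp add: reduction_def rev_map)

lemma length_reduction [simp]: "length (reduction w) = length w"
  by (simp add: reduction_def)

definition has_window :: "nat list \<Rightarrow> nat list \<Rightarrow> bool" where
  "has_window p xs \<longleftrightarrow> (\<exists>u w v. xs = u @ w @ v \<and> reduction w = p)"

text \<open>Here \<open>m\<close> stands for the maximum of the entries that precede
  \<open>xs\<close>, so \<open>z\<close> ranges over candidates for an earlier, larger
  entry.\<close>

definition has_low_window :: "nat list \<Rightarrow> nat \<Rightarrow> nat list \<Rightarrow> bool" where
  "has_low_window p m xs \<longleftrightarrow>
     (\<exists>u w v. xs = u @ w @ v \<and> reduction w = p \<and> (\<exists>z\<in>insert m (set u). \<forall>x\<in>set w. x < z))"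

lemma has_window_rev: "has_window p (rev xs) \<longleftrightarrow> has_window (rev p) xs"
proof -
  have "has_window (rev p) (rev xs)" if "has_window p xs" for p xs
  proof -
    from that obtain u w v where "xs = u @ w @ v" "reduction w = p"
      unfolding has_window_def by blast
    then have "rev xs = rev v @ rev w @ rev u" "reduction (rev w) = rev p"
      by (simp_all add: reduction_rev)
    then show ?thesis
      unfolding has_window_def by blast
  qed
  from this [of p "rev xs"] this [of "rev p" xs] show ?thesis
    by auto
qed

lemma has_low_window_last:
  assumes "\<forall>x\<in>set b. x < m"
  shows "has_low_window p m b \<longleftrightarrow> has_window p b"
proof
  assume "has_window p b"
  then obtain u w v where "b = u @ w @ v" "reduction w = p"
    unfolding has_window_def by blast
  moreover from this assms have "\<forall>x\<in>set w. x < m"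
    by simp
  ultimately show "has_low_window p m b"
    unfolding has_low_window_def by blast
qed (auto simp: has_low_window_def has_window_def)

text \<open>A low window cannot contain \<open>y\<close>, since nothing before \<open>y\<close>
  exceeds it. Inside \<open>b\<close> every window is low because of \<open>m\<close>; inside
  \<open>ys\<close> the value \<open>y\<close> dominates all that precedes
  \<open>ys\<close>.\<close>

lemma has_low_window_run:
  assumes b: "\<forall>x\<in>set b. x < m" and y: "m \<le> y" and p: "p \<noteq> []"
  shows "has_low_window p m (b @ y # ys) \<longleftrightarrow> has_window p b \<or> has_low_window p y ys"
proof
  assume "has_low_window p m (b @ y # ys)"
  then obtain u w v z where eq: "b @ y # ys = u @ w @ v" and w: "reduction w = p"
    and z: "z \<in> insert m (set u)" "\<forall>x\<in>set w. x < z"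
    unfolding has_low_window_def by blast
  \<comment> \<open>The window ends within \<open>b\<close>, starts after \<open>y\<close>, or
    covers \<open>y\<close>; in the last case \<open>u\<close> is a prefix of \<open>b\<close>,
    which forces \<open>z \<le> m \<le> y\<close>.\<close>
  consider (before) t where "b = (u @ w) @ t" | (after) t where "u = b @ y # t" "ys = t @ w @ v"
    | (inside) t where "u @ t = b" "y \<in> set w"
  proof -
    from eq consider t where "b = (u @ w) @ t" | t where "u @ w = b @ t" "y # ys = t @ v" "t \<noteq> []"
      by (metis append_eq_append_conv2 append_Nil2)
    then show ?thesis
    proof cases
      case 1
      then show ?thesis using before by blast
    next
      case (2 t)
      then obtain t' where t: "t = y # t'" "ys = t' @ v"
        by (cases t) auto
      from 2(1) consider s where "u = b @ s" "t = s @ w" | s where "u @ s = b" "w = s @ t"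
        by (metis append_eq_append_conv2)
      then show ?thesis
      proof cases
        case (1 s)
        show ?thesis
        proof (cases s)
          case Nil
          then show ?thesis using 1 t inside [of "[]"] by auto
        next
          case (Cons a s')
          then show ?thesis using 1 t after [of s'] by auto
        qed
      next
        case (2 s)
        then show ?thesis using t inside [of s] by auto
      qed
    qed
  qed
  then show "has_window p b \<or> has_low_window p y ys"
  proof cases
    case before
    then show ?thesis
      using w by (auto simp: has_window_def)
  next
    case (after t)
    have "z \<le> y \<or> z \<in> set t"
      using z(1) b y after(1) by force
    then have "\<exists>z\<in>insert y (set t). \<forall>x\<in>set w. x < z"
      using z(2) by (meson insertI1 insertI2 less_le_trans)
    then show ?thesis
      using after(2) w unfolding has_low_window_def by blast
  next
    case inside
    then have "y < z" "z \<le> m"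
      using z b by (auto intro: less_imp_le)
    then show ?thesis
      using y by simp
  qed
next
  assume "has_window p b \<or> has_low_window p y ys"
  then show "has_low_window p m (b @ y # ys)"
  proof
    assume "has_window p b"
    then obtain u w v where "b = u @ w @ v" "reduction w = p"
      unfolding has_window_def by blast
    with b show ?thesis
      unfolding has_low_window_def
      by (intro exI [of _ u] exI [of _ w] exI [of _ "v @ y # ys"]) auto
  next
    assume "has_low_window p y ys"
    then obtain u w v z where "ys = u @ w @ v" "reduction w = p"
      "z \<in> insert y (set u)" "\<forall>x\<in>set w. x < z"
      unfolding has_low_window_def by blast
    then show ?thesis
      unfolding has_low_window_def
      by (intro exI [of _ "b @ y # u"] exI [of _ w] exI [of _ v]) auto
  qed
qed

text \<open>By the two preceding lemmas only windows inside single runs matter, and reversing a run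
  exchanges \<open>p\<close> with \<open>rev p\<close> by \<open>has_window_rev\<close>.\<close>

lemma has_low_window_reverse_runs:
  assumes "p \<noteq> []"
  shows "has_low_window p m (reverse_runs m xs) \<longleftrightarrow> has_low_window (rev p) m xs"
  using assms
  by (induction m xs rule: runs_induct)
    (simp_all add: reverse_runs_last reverse_runs_run has_low_window_last has_low_window_run
      has_window_rev)

section \<open>Occurrences as low windows\<close>

text \<open>If some \<open>x\<close> in \<open>w\<close> were at least \<open>z\<close>, its rank
  would be at least that of \<open>z\<close>, which exceeds every entry of \<open>p\<close>.
  Conversely, a \<open>z\<close> above all of \<open>w\<close> leaves the ranks in \<open>w\<close>
  unchanged and has as rank the number of distinct values of \<open>w\<close>, one more than the
  rank of the largest of them.\<close>

lemma reduction_eq_Cons: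
  assumes "p \<noteq> []"
  shows "reduction (z # w) = Suc (Max (set p)) # p \<longleftrightarrow> reduction w = p \<and> (\<forall>x\<in>set w. x < z)"
proof
  let ?rank = "\<lambda>x. card {y \<in> set (z # w). y < x}"
  assume red: "reduction (z # w) = Suc (Max (set p)) # p"
  have below: "x < z" if x: "x \<in> set w" for x
  proof (rule ccontr)
    assume "\<not> x < z"
    then have "?rank z \<le> ?rank x"
      by (intro card_mono) auto
    moreover have "?rank x \<in> set p" "?rank z = Suc (Max (set p))"
      using red x by (auto simp: reduction_def)
    moreover from this have "?rank x \<le> Max (set p)"
      by (intro Max_ge) simp_all
    ultimately show False
      by linarith
  qed
  then have "{y \<in> set (z # w). y < x} = {y \<in> set w. y < x}" if "x \<in> set w" for x
    using below [OF that] by auto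
  then have "reduction w = p"
    using red by (auto simp: reduction_def)
  then show "reduction w = p \<and> (\<forall>x\<in>set w. x < z)"
    using below by blast
next
  assume asm: "reduction w = p \<and> (\<forall>x\<in>set w. x < z)"
  then have below: "\<forall>x\<in>set w. x < z" and w: "w \<noteq> []"
    using assms by (auto simp: reduction_def)
  let ?M = "Max (set w)"
  have M: "?M \<in> set w"
    using w by simp
  have "{y \<in> set w. y < ?M} = set w - {?M}"
    using Max_ge [of "set w"] by (auto simp: less_le)
  then have "Suc (card {y \<in> set w. y < ?M}) = card (set w)"
    using card_Suc_Diff1 [OF _ M] by simp
  moreover have "Max (set p) = card {y \<in> set w. y < ?M}"
  proof (rule Max_eqI)
    show "card {y \<in> set w. y < ?M} \<in> set p"
      using asm M by (auto simp: reduction_def)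
    fix c assume "c \<in> set p"
    then obtain x where "x \<in> set w" "c = card {y \<in> set w. y < x}"
      using asm by (auto simp: reduction_def)
    moreover from this have "{y \<in> set w. y < x} \<subseteq> {y \<in> set w. y < ?M}"
      using Max_ge [of "set w" x] less_le_trans by blast
    ultimately show "c \<le> card {y \<in> set w. y < ?M}"
      by (simp add: card_mono)
  qed simp
  moreover have "{y \<in> set (z # w). y < z} = set w"
    using below by auto
  moreover have "{y \<in> set (z # w). y < x} = {y \<in> set w. y < x}" if "x \<in> set w" for x
    using that below by auto
  ultimately show "reduction (z # w) = Suc (Max (set p)) # p"
    using asm by (auto simp: reduction_def)
qed

lemma same_block_singleton_Cons:
  "same_block [[a], p] t \<longleftrightarrow> 1 \<le> t \<and> t < length p"
  by (auto simp: same_block_def less_Suc_eq)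

text \<open>Adjacency turns the positions matched to \<open>p\<close> into an interval, and
  \<open>reduction_eq_Cons\<close> turns the leading letter into an earlier entry above that
  window.\<close>

lemma contains_iff_low_window:
  assumes p: "p \<noteq> []"
  shows "contains e [[Max (set p) + 1], p] \<longleftrightarrow> has_low_window p 0 e"
proof
  assume "contains e [[Max (set p) + 1], p]"
  then obtain "is" where occ: "occurrence [[Max (set p) + 1], p] e is"
    unfolding contains_def by blast
  then have red: "reduction (map ((!) e) is) = Suc (Max (set p)) # p"
    by (simp add: occurrence_def)
  then have "length is = Suc (length p)"
    by (metis length_Cons length_map length_reduction)
  then obtain i js where ijs: "is = i # js" and len: "length js = length p"
    by (cases "is") auto
  \<comment> \<open>Position \<open>t\<close> of \<open>p\<close> is position \<open>Suc t\<close>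
    of the whole pattern, because of the leading letter.\<close>
  have step: "js ! Suc t = Suc (js ! t)" if "Suc t < length p" for t
    using occ that len unfolding occurrence_def ijs
    by (auto simp: same_block_singleton_Cons dest: spec [of _ "Suc t"])
  define a where "a = js ! 0"
  have js: "js ! t = a + t" if "t < length p" for t
    using that by (induction t) (auto simp: a_def step)
  have i: "i < a" and a: "a + length p \<le> length e"
  proof -
    show "i < a"
      using occ p len unfolding occurrence_def ijs a_def by auto
    have "js ! (length p - 1) \<in> set js"
      using p len by simp
    then have "js ! (length p - 1) < length e"
      using occ unfolding occurrence_def ijs by auto
    then show "a + length p \<le> length e"
      using p js [of "length p - 1"] by (cases p) auto
  qed
  let ?w = "take (length p) (drop a e)"
  have w: "map ((!) e) js = ?w"
    using len js a by (intro nth_equalityI) auto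
  have e: "e = take a e @ ?w @ drop (length p) (drop a e)"
    by (metis append_take_drop_id)
  have "reduction (e ! i # ?w) = Suc (Max (set p)) # p"
    using red w ijs by simp
  then have "reduction ?w = p" "\<forall>x\<in>set ?w. x < e ! i"
    using reduction_eq_Cons [OF p] by blast+
  moreover have "e ! i \<in> set (take a e)"
    using i a by (auto simp: in_set_conv_nth intro!: exI [of _ i])
  ultimately show "has_low_window p 0 e"
    unfolding has_low_window_def using e by blast
next
  assume "has_low_window p 0 e"
  then obtain u w v z where e: "e = u @ w @ v" and w: "reduction w = p"
    and z: "z \<in> insert 0 (set u)" "\<forall>x\<in>set w. x < z"
    unfolding has_low_window_def by blast
  have "w \<noteq> []"
    using w p by (auto simp: reduction_def)
  \<comment> \<open>The initial bound 0 lies above no natural number, so \<open>z\<close> is an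
    actual entry of \<open>e\<close>.\<close>
  then have "z \<in> set u"
    using z by (cases w) auto
  then obtain i where i: "i < length u" "u ! i = z"
    by (auto simp: in_set_conv_nth)
  have len: "length w = length p"
    using w by auto
  let ?is = "i # [length u ..< length u + length w]"
  have "map ((!) e) ?is = z # w"
    using i by (auto simp: e nth_append intro!: nth_equalityI)
  moreover have "reduction (z # w) = Suc (Max (set p)) # p"
    using reduction_eq_Cons [OF p] w z by blast
  ultimately have "occurrence [[Max (set p) + 1], p] e ?is"
    using i len unfolding occurrence_def
    by (auto simp: e same_block_singleton_Cons nth_Cons split: nat.splits)
  then show "contains e [[Max (set p) + 1], p]"
    unfolding contains_def by blast
qed

theorem theorem2p2:
  fixes p :: "nat list" and d :: nat
  assumes "consecutive_pattern p"
    and "d = Max (set p)"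
  shows "wilf_equivalent [[d + 1], p] [[d + 1], rev p]"
  unfolding wilf_equivalent_def
proof
  fix n
  have p: "p \<noteq> []"
    using assms(1) by (simp add: consecutive_pattern_def vincular_pattern_def)
  \<comment> \<open>The same \<open>d\<close> serves both patterns, as \<open>rev p\<close> has the
    same entries as \<open>p\<close>.\<close>
  have iff: "avoids e [[d + 1], p] \<longleftrightarrow> \<not> has_low_window p 0 e"
    "avoids e [[d + 1], rev p] \<longleftrightarrow> \<not> has_low_window (rev p) 0 e" for e
    using contains_iff_low_window [of p e] contains_iff_low_window [of "rev p" e] p assms(2)
    by (simp_all add: avoids_def)
  have flip: "avoids (reverse_runs 0 e) [[d + 1], p] \<longleftrightarrow> avoids e [[d + 1], rev p]" for e
    unfolding iff using has_low_window_reverse_runs [OF p] by simp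
  then have flip': "avoids (reverse_runs 0 e) [[d + 1], rev p] \<longleftrightarrow> avoids e [[d + 1], p]" for e
    by (metis reverse_runs_involution)
  have "bij_betw (reverse_runs 0) {e \<in> inversion_sequences n. avoids e [[d + 1], p]}
      {e \<in> inversion_sequences n. avoids e [[d + 1], rev p]}"
    by (rule bij_betw_byWitness [where f' = "reverse_runs 0"])
      (auto simp: reverse_runs_involution reverse_runs_inversion_sequences
        flip [simplified] flip' [simplified])
  then show "card {e \<in> inversion_sequences n. avoids e [[d + 1], p]} =
      card {e \<in> inversion_sequences n. avoids e [[d + 1], rev p]}"
    by (rule bij_betw_same_card)
qed

end
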